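(* Let $u$ be a smooth function on $\bar\Omega$ (with bounded derivatives), let $w\in\mathbb R^n$ be a unit vector, $x_0\in\mathcal G$, and let the angular resolution $d\theta\in(0,\pi)$ be fixed. The first derivative schemes $\mathcal D_wu(x_0)$ and $\mathcal D_{-w}u(x_0)$ built from admissible simplices $\mathcal S_p,\mathcal S_m$ (defined in the context) are consistent with discretization error $\mathcal O(h)$: as $h\to0$, $$\left|\mathcal D_wu(x_0)-\langle w,Du(x_0)\rangle\right|=\mathcal O(h),\qquad \left|\mathcal D_{-w}u(x_0)-\langle -w,Du(x_0)\rangle\right|=\mathcal O(h),$$ where the constants may depend on $u$, $n$ and $d\theta$ but not on $h$, $x_0$, $w$ or the choice of admissible simplices.
   Context: $n\in\{2,3\}$; $\Omega\subset\mathbb R^n$ is an open convex bounded domain with Lipschitz boundary; $\mathcal G\subset\bar\Omega$ is a finite point cloud with spatial resolution $h=\sup_{x\in\Omega}\min_{y\in\mathcal G}\|x-y\|$. Put $C_2=2$ and $C_3=1+\frac2{\sqrt3}$. For an angular resolution $0<d\theta<\pi$, the maximal and minimal search radii are $$R=C_nh\left(1+\operatorname{cosec}\tfrac{d\theta}2\right),\qquad r=C_nh\left(-1+\operatorname{cosec}\tfrac{d\theta}2\right).$$ Admissible simplices: $\mathcal S_p$ and $\mathcal S_m$ are sets of $n$ points of $\mathcal G$, each being the vertex set of an $(n-1)$-dimensional simplex. Every vertex $x_i$ of either satisfies $r\le\|x_i-x_0\|\le R$, and any two vertices of the same simplex are at distance at most $2C_nh$. The matrices $V_p$, $V_m$,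 whose columns are the vectors $x_i-x_0$ for $x_i\in\mathcal S_p$, respectively $x_i\in\mathcal S_m$, are invertible. There are $t_p,t_m\in[r,R]$ such that $x_0+t_pw$ lies in the convex hull of $\mathcal S_p$ and $x_0-t_mw$ lies in the convex hull of $\mathcal S_m$. Consequently $t_p=\frac1{\mathbf 1^{\mathsf T}V_p^{-1}w}$ and $t_m=\frac{-1}{\mathbf 1^{\mathsf T}V_m^{-1}w}$, where $\mathbf 1$ is the all-ones vector. (For $\mathcal D_w$ only $\mathcal S_p$ is needed, for $\mathcal D_{-w}$ only $\mathcal S_m$.) Linear interpolants: $L_p(x)=\sum_{i\in\mathcal S_p}\lambda_p^i(x)u(x_i)$, where for $x$ in the simplex $\lambda_p(x)$ is the vector of barycentric coordinates, solving $V_p\lambda_p=x-x_0$; $L_m$ and $\lambda_m$ are defined in the same way using $\mathcal S_m,V_m$. Schemes: $$\mathcal D_wu(x_0)=\frac{L_p(x_0+t_pw)-u(x_0)}{t_p},\qquad \mathcal D_{-w}u(x_0)=\frac{L_m(x_0-t_mw)-u(x_0)}{t_m}.$$ *)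

theory Defs
  imports "HOL-Analysis.Analysis"
begin

text \<open>A set has Lipschitz boundary if near each boundary point it is, in suitable orthonormal
  coordinates with last axis \<open>e\<close>, the strict epigraph of a Lipschitz function \<open>\<gamma>\<close> on the hyperplane
  orthogonal to \<open>e\<close>.\<close>

definition lipschitz_boundary :: "(real ^ 'n) set \<Rightarrow> bool" where
  "lipschitz_boundary \<Omega> \<longleftrightarrow>
     (\<forall>p\<in>frontier \<Omega>. \<exists>U e L. \<exists>\<gamma> :: real ^ 'n \<Rightarrow> real.
        open U \<and> p \<in> U \<and> norm e = 1 \<and> L-lipschitz_on {y. y \<bullet> e = 0} \<gamma> \<and>
        \<Omega> \<inter> U = {x \<in> U. \<gamma> (x - (x \<bullet> e) *\<^sub>R e) < x \<bullet> e})"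

text \<open>Derivatives are taken within \<open>S\<close>, hence are one-sided at boundary points. They are used for
  \<open>S\<close> the closure of an open convex set, where derivatives within \<open>S\<close> are unique.\<close>

definition grad_within :: "(real ^ 'n) set \<Rightarrow> (real ^ 'n \<Rightarrow> real) \<Rightarrow> real ^ 'n \<Rightarrow> real ^ 'n" where
  "grad_within S f x = (\<chi> i. frechet_derivative f (at x within S) (axis i 1))"

fun iter_partial ::
    "(real ^ 'n) set \<Rightarrow> (real ^ 'n \<Rightarrow> real) \<Rightarrow> 'n list \<Rightarrow> real ^ 'n \<Rightarrow> real" where
  "iter_partial S f [] = f"
| "iter_partial S f (i # is) = (\<lambda>x. grad_within S (iter_partial S f is) x $ i)"

definition smooth_bounded_on :: "(real ^ 'n) set \<Rightarrow> (real ^ 'n \<Rightarrow> real) \<Rightarrow> bool" where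
  "smooth_bounded_on S f \<longleftrightarrow>
     (\<forall>is. iter_partial S f is differentiable_on S \<and> bounded (iter_partial S f is ` S))"

definition spatial_resolution :: "(real ^ 'n) set \<Rightarrow> (real ^ 'n) set \<Rightarrow> real" where
  "spatial_resolution \<Omega> \<G> = (SUP x\<in>\<Omega>. MIN y\<in>\<G>. norm (x - y))"

text \<open>Only the dimensions 2 and 3 are relevant.\<close>

definition dim_const :: "nat \<Rightarrow> real" where
  "dim_const n = (if n = 2 then 2 else 1 + 2 / sqrt 3)"

definition max_radius :: "nat \<Rightarrow> real \<Rightarrow> real \<Rightarrow> real" where
  "max_radius n d\<theta> h = dim_const n * h * (1 + 1 / sin (d\<theta> / 2))"

definition min_radius :: "nat \<Rightarrow> real \<Rightarrow> real \<Rightarrow> real" where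
  "min_radius n d\<theta> h = dim_const n * h * (- 1 + 1 / sin (d\<theta> / 2))"

text \<open>The \<open>n\<close> vertices of a simplex are given by an enumeration \<open>X\<close> indexed by the coordinate type,
  so that the vectors \<open>X j - x0\<close> are the columns of a square matrix.\<close>

definition edge_matrix :: "real ^ 'n \<Rightarrow> ('n \<Rightarrow> real ^ 'n) \<Rightarrow> real ^ 'n ^ 'n" where
  "edge_matrix x0 X = (\<chi> i j. (X j - x0) $ i)"

text \<open>Admissibility for the direction \<open>v\<close>, where \<open>x0 + t *\<^sub>R v\<close> is the point at which the ray from
  \<open>x0\<close> meets the simplex; \<open>v = w\<close> for the forward and \<open>v = - w\<close> for the backward scheme.\<close>

definition admissible ::
    "(real ^ 'n) set \<Rightarrow> real \<Rightarrow> real \<Rightarrow> real ^ 'n \<Rightarrow> real ^ 'n \<Rightarrow> ('n \<Rightarrow> real ^ 'n) \<Rightarrow> real \<Rightarrow> bool"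
  where
  "admissible \<G> d\<theta> h x0 v X t \<longleftrightarrow>
     range X \<subseteq> \<G> \<and> inj X \<and> \<not> affine_dependent (range X) \<and>
     (\<forall>i. norm (X i - x0) \<in> {min_radius CARD('n) d\<theta> h .. max_radius CARD('n) d\<theta> h}) \<and>
     (\<forall>i j. norm (X i - X j) \<le> 2 * dim_const CARD('n) * h) \<and>
     invertible (edge_matrix x0 X) \<and>
     t \<in> {min_radius CARD('n) d\<theta> h .. max_radius CARD('n) d\<theta> h} \<and>
     x0 + t *\<^sub>R v \<in> convex hull (range X)"

definition bary_coords :: "real ^ 'n \<Rightarrow> ('n \<Rightarrow> real ^ 'n) \<Rightarrow> real ^ 'n \<Rightarrow> real ^ 'n" where
  "bary_coords x0 X x = (THE l. edge_matrix x0 X *v l = x - x0)"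

definition lin_interp ::
    "(real ^ 'n \<Rightarrow> real) \<Rightarrow> real ^ 'n \<Rightarrow> ('n \<Rightarrow> real ^ 'n) \<Rightarrow> real ^ 'n \<Rightarrow> real" where
  "lin_interp u x0 X x = (\<Sum>i\<in>UNIV. bary_coords x0 X x $ i * u (X i))"

definition dir_scheme ::
    "(real ^ 'n \<Rightarrow> real) \<Rightarrow> real ^ 'n \<Rightarrow> ('n \<Rightarrow> real ^ 'n) \<Rightarrow> real \<Rightarrow> real ^ 'n \<Rightarrow> real" where
  "dir_scheme u x0 X t v = (lin_interp u x0 X (x0 + t *\<^sub>R v) - u x0) / t"

end

theory Submission imports Defs begin

text \<open>Why the schemes are consistent. Since \<open>x0 + t *\<^sub>R v\<close> lies in the simplex, its
  barycentric coordinates \<open>l\<close> are nonnegative with sum 1, and the edge matrix sends them to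
  \<open>t *\<^sub>R v\<close>. The scheme is therefore a convex combination of the differences
  \<open>u (X i) - u x0\<close>, divided by \<open>t\<close>. The first-order Taylor terms recombine, by the same weights, to
  \<open>t * (v \<bullet> Du x0)\<close> exactly, so that only the Taylor remainders survive: at most \<open>K * R\<^sup>2\<close> for the
  maximal radius \<open>R\<close>, hence \<open>K * R\<^sup>2 / r\<close> after division by \<open>t\<close>, which is at least the minimal
  radius \<open>r\<close>. Both radii are fixed multiples of \<open>h\<close>, and the multiple for \<open>r\<close> is positive
  because \<open>sin (d\<theta> / 2) < 1\<close>; this makes the error \<open>O(h)\<close>, with a constant determined by \<open>K\<close>, the
  dimension and \<open>d\<theta>\<close>.

  The remainder bound (lemma \<open>smooth_bounded_on_taylor_remainder\<close>) uses the mean value inequality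
  twice on the convex set \<open>closure \<Omega>\<close>: bounded second derivatives make the gradient Lipschitz,
  and a Lipschitz gradient makes the linearization error quadratic. The backward scheme is the
  forward one for the direction \<open>- w\<close>.\<close>

section \<open>Gradients and Taylor remainders on convex sets\<close>

text \<open>Any derivative within \<open>S\<close> is determined as a linear map by its values on the axes. Hence the
  gradient represents the derivative selected by \<^const>\<open>frechet_derivative\<close>, also at boundary
  points.\<close>

lemma has_derivative_grad_within:
  fixes f :: "real ^ 'n \<Rightarrow> real"
  assumes "f differentiable (at x within S)"
  shows "(f has_derivative (\<lambda>y. grad_within S f x \<bullet> y)) (at x within S)"
proof -
  define D where "D = frechet_derivative f (at x within S)"
  have D: "(f has_derivative D) (at x within S)"
    using assms frechet_derivative_works unfolding D_def by blast
  interpret linear D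
    using D has_derivative_linear by blast
  have "D y = grad_within S f x \<bullet> y" for y
  proof -
    have "D y = D (\<Sum>i\<in>UNIV. y $ i *\<^sub>R axis i 1)"
      by (simp add: basis_expansion scalar_mult_eq_scaleR [symmetric])
    also have "\<dots> = (\<Sum>i\<in>UNIV. y $ i * D (axis i 1))"
      by (simp add: sum scaleR)
    also have "\<dots> = grad_within S f x \<bullet> y"
      by (simp add: inner_vec_def grad_within_def D_def mult.commute)
    finally show ?thesis .
  qed
  then have "D = (\<lambda>y. grad_within S f x \<bullet> y)"
    by blast
  with D show ?thesis
    by simp
qed

lemma onorm_inner_right_le: "onorm (\<lambda>y. a \<bullet> y) \<le> norm (a :: 'a :: real_inner)"
  by (rule onorm_bound) (simp_all add: Cauchy_Schwarz_ineq2)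

lemma lipschitz_of_grad_within_bound:
  fixes f :: "real ^ 'n \<Rightarrow> real"
  assumes "convex S" and "f differentiable_on S"
    and "\<And>x. x \<in> S \<Longrightarrow> norm (grad_within S f x) \<le> B"
    and "x \<in> S" and "y \<in> S"
  shows "\<bar>f y - f x\<bar> \<le> B * norm (y - x)"
proof -
  have "norm (f y - f x) \<le> B * norm (y - x)"
  proof (rule differentiable_bound [OF \<open>convex S\<close> _ _ \<open>y \<in> S\<close> \<open>x \<in> S\<close>])
    fix z assume "z \<in> S"
    show "(f has_derivative (\<lambda>y. grad_within S f z \<bullet> y)) (at z within S)"
      using assms(2) \<open>z \<in> S\<close> by (intro has_derivative_grad_within) (simp add: differentiable_on_def)
    show "onorm (\<lambda>y. grad_within S f z \<bullet> y) \<le> B"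
      using onorm_inner_right_le assms(3) [OF \<open>z \<in> S\<close>] by (rule order_trans)
  qed
  then show ?thesis
    by simp
qed

lemma norm_grad_within_bounded:
  fixes f :: "real ^ 'n \<Rightarrow> real"
  assumes "\<And>i. bounded ((\<lambda>x. grad_within S f x $ i) ` S)"
  obtains B where "\<And>x. x \<in> S \<Longrightarrow> norm (grad_within S f x) \<le> B"
proof -
  have "\<exists>b. \<forall>i. \<forall>x\<in>S. \<bar>grad_within S f x $ i\<bar> \<le> b i"
    using assms by (intro choice) (auto simp: bounded_iff)
  then obtain b where b: "\<And>i x. x \<in> S \<Longrightarrow> \<bar>grad_within S f x $ i\<bar> \<le> b i"
    by blast
  have "norm (grad_within S f x) \<le> (\<Sum>i\<in>UNIV. b i)" if "x \<in> S" for x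
    using norm_le_l1_cart [of "grad_within S f x"] sum_mono [of UNIV, OF b [OF that]]
    by (rule order_trans)
  then show ?thesis
    using that by blast
qed

text \<open>Each partial derivative is Lipschitz because its own gradient, a row of second derivatives, is
  bounded; adding up the components gives a Lipschitz constant of the gradient.\<close>

lemma smooth_bounded_on_grad_lipschitz:
  fixes f :: "real ^ 'n \<Rightarrow> real"
  assumes "convex S" and "smooth_bounded_on S f"
  obtains K where "K \<ge> 0"
    and "\<And>x y. x \<in> S \<Longrightarrow> y \<in> S \<Longrightarrow>
           norm (grad_within S f y - grad_within S f x) \<le> K * norm (y - x)"
proof -
  have "\<exists>B. \<forall>x\<in>S. \<forall>y\<in>S. \<bar>grad_within S f y $ i - grad_within S f x $ i\<bar> \<le> B * norm (y - x)"
    for i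
  proof -
    let ?g = "\<lambda>x. grad_within S f x $ i"
    have "bounded ((\<lambda>x. grad_within S ?g x $ j) ` S)" for j
      using assms(2) unfolding smooth_bounded_on_def by (auto dest: spec [of _ "[j, i]"])
    then obtain B where B: "\<And>x. x \<in> S \<Longrightarrow> norm (grad_within S ?g x) \<le> B"
      using norm_grad_within_bounded [of S ?g] by blast
    have "?g differentiable_on S"
      using assms(2) unfolding smooth_bounded_on_def by (auto dest: spec [of _ "[i]"])
    then show ?thesis
      using lipschitz_of_grad_within_bound [OF assms(1) _ B] by blast
  qed
  then obtain b where b: "\<And>i x y. x \<in> S \<Longrightarrow> y \<in> S \<Longrightarrow>
      \<bar>grad_within S f y $ i - grad_within S f x $ i\<bar> \<le> b i * norm (y - x)"
    by metis
  have "norm (grad_within S f y - grad_within S f x) \<le> (\<Sum>i\<in>UNIV. \<bar>b i\<bar>) * norm (y - x)"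
    if "x \<in> S" "y \<in> S" for x y
  proof -
    have "norm (grad_within S f y - grad_within S f x)
        \<le> (\<Sum>i\<in>UNIV. \<bar>grad_within S f y $ i - grad_within S f x $ i\<bar>)"
      using norm_le_l1_cart [of "grad_within S f y - grad_within S f x"] by simp
    also have "\<dots> \<le> (\<Sum>i\<in>UNIV. \<bar>b i\<bar> * norm (y - x))"
      using b [OF that] by (intro sum_mono) (meson abs_ge_self mult_right_mono norm_ge_zero order_trans)
    finally show ?thesis
      by (simp add: sum_distrib_right)
  qed
  then show ?thesis
    by (intro that [of "\<Sum>i\<in>UNIV. \<bar>b i\<bar>"]) (auto intro: sum_nonneg)
qed

text \<open>Subtract the linear part at \<open>x\<close> and apply the mean value inequality on the segment from \<open>x\<close>
  to \<open>y\<close>, along which the gradient differs from its value at \<open>x\<close> by at most \<open>K * norm (y - x)\<close>.\<close>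

lemma smooth_bounded_on_taylor_remainder:
  fixes f :: "real ^ 'n \<Rightarrow> real"
  assumes "convex S" and "smooth_bounded_on S f"
  obtains K where "K \<ge> 0"
    and "\<And>x y. x \<in> S \<Longrightarrow> y \<in> S \<Longrightarrow>
           \<bar>f y - f x - grad_within S f x \<bullet> (y - x)\<bar> \<le> K * (norm (y - x))\<^sup>2"
proof -
  obtain K where "K \<ge> 0" and K: "\<And>x y. x \<in> S \<Longrightarrow> y \<in> S \<Longrightarrow>
      norm (grad_within S f y - grad_within S f x) \<le> K * norm (y - x)"
    using smooth_bounded_on_grad_lipschitz [OF assms] by blast
  have diff: "f differentiable_on S"
    using assms(2) unfolding smooth_bounded_on_def by (auto dest: spec [of _ "[]"])
  have "\<bar>f y - f x - grad_within S f x \<bullet> (y - x)\<bar> \<le> K * (norm (y - x))\<^sup>2"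
    if x: "x \<in> S" and y: "y \<in> S" for x y
  proof -
    let ?T = "closed_segment x y"
    let ?g = "grad_within S f"
    have sub: "?T \<subseteq> S"
      using assms(1) x y by (rule closed_segment_subset [rotated 2])
    have der: "((\<lambda>z. f z - ?g x \<bullet> z) has_derivative (\<lambda>v. (?g z - ?g x) \<bullet> v)) (at z within ?T)"
      if "z \<in> ?T" for z
    proof -
      have "(f has_derivative (\<lambda>v. ?g z \<bullet> v)) (at z within S)"
        using diff sub that by (intro has_derivative_grad_within) (auto simp: differentiable_on_def)
      then have "(f has_derivative (\<lambda>v. ?g z \<bullet> v)) (at z within ?T)"
        using sub by (rule has_derivative_subset)
      then show ?thesis
        by (auto intro!: derivative_eq_intros simp: inner_diff_left)
    qed
    have "norm ((f y - ?g x \<bullet> y) - (f x - ?g x \<bullet> x)) \<le> (K * norm (y - x)) * norm (y - x)"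
    proof (rule differentiable_bound [OF convex_closed_segment der])
      fix z assume z: "z \<in> ?T"
      have "onorm (\<lambda>v. (?g z - ?g x) \<bullet> v) \<le> norm (?g z - ?g x)"
        by (rule onorm_inner_right_le)
      also have "\<dots> \<le> K * norm (z - x)"
        using K x z sub by blast
      also have "\<dots> \<le> K * norm (y - x)"
        using segment_bound(1) [OF z] \<open>K \<ge> 0\<close> by (intro mult_left_mono) (auto simp: norm_minus_commute)
      finally show "onorm (\<lambda>v. (?g z - ?g x) \<bullet> v) \<le> K * norm (y - x)" .
    qed auto
    then show ?thesis
      by (simp add: inner_diff_right power2_eq_square algebra_simps)
  qed
  then show ?thesis
    using that \<open>K \<ge> 0\<close> by blast
qed

section \<open>Barycentric weights and the scheme\<close>

lemma edge_matrix_mult: "edge_matrix x0 X *v l = (\<Sum>i\<in>UNIV. l $ i *\<^sub>R (X i - x0))"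
  by (simp add: edge_matrix_def vec_eq_iff matrix_vector_mult_def mult.commute)

text \<open>Convex weights for a point of the simplex, with the base point \<open>x0\<close> subtracted at each
  vertex, solve the linear system that defines the barycentric coordinates; invertibility makes the
  solution unique.\<close>

lemma bary_coords_convex_weights:
  fixes X :: "'n \<Rightarrow> real ^ 'n"
  assumes "inj X" and "invertible (edge_matrix x0 X)" and "x \<in> convex hull (range X)"
  shows "\<And>i. bary_coords x0 X x $ i \<ge> 0"
    and "(\<Sum>i\<in>UNIV. bary_coords x0 X x $ i) = 1"
    and "(\<Sum>i\<in>UNIV. bary_coords x0 X x $ i *\<^sub>R (X i - x0)) = x - x0"
proof -
  obtain c where c: "\<And>y. y \<in> range X \<Longrightarrow> 0 \<le> c y" "sum c (range X) = 1"
    "(\<Sum>y\<in>range X. c y *\<^sub>R y) = x"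
    using assms(3) by (auto simp: convex_hull_finite)
  define l where "l = (\<chi> i. c (X i))"
  have sum1: "(\<Sum>i\<in>UNIV. l $ i) = 1" and "(\<Sum>i\<in>UNIV. l $ i *\<^sub>R X i) = x"
    using c(2,3) by (simp_all add: l_def sum.reindex [OF assms(1)])
  then have comb: "(\<Sum>i\<in>UNIV. l $ i *\<^sub>R (X i - x0)) = x - x0"
    by (simp add: scaleR_diff_right sum_subtractf flip: scaleR_sum_left)
  have "bary_coords x0 X x = l"
    unfolding bary_coords_def
  proof (rule the_equality)
    show "edge_matrix x0 X *v l = x - x0"
      using comb by (simp add: edge_matrix_mult)
    show "m = l" if "edge_matrix x0 X *v m = x - x0" for m
      using that \<open>edge_matrix x0 X *v l = x - x0\<close> inj_matrix_vector_mult [OF assms(2)]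
      by (metis injD)
  qed
  with sum1 comb c(1) show "\<And>i. bary_coords x0 X x $ i \<ge> 0"
    and "(\<Sum>i\<in>UNIV. bary_coords x0 X x $ i) = 1"
    and "(\<Sum>i\<in>UNIV. bary_coords x0 X x $ i *\<^sub>R (X i - x0)) = x - x0"
    by (simp_all add: l_def)
qed

text \<open>The vector \<open>g\<close> stands for the gradient at \<open>x0\<close>. The weights reproduce linear functions
  exactly, so the error is a convex combination of the remainders at the vertices.\<close>

lemma dir_scheme_error:
  fixes X :: "'n \<Rightarrow> real ^ 'n"
  assumes "inj X" and "invertible (edge_matrix x0 X)"
    and "x0 + t *\<^sub>R v \<in> convex hull (range X)" and "t > 0"
    and rem: "\<And>i. \<bar>u (X i) - u x0 - g \<bullet> (X i - x0)\<bar> \<le> E"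
  shows "\<bar>dir_scheme u x0 X t v - v \<bullet> g\<bar> \<le> E / t"
proof -
  define l where "l = bary_coords x0 X (x0 + t *\<^sub>R v)"
  have l_nonneg: "\<And>i. l $ i \<ge> 0" and l_sum: "(\<Sum>i\<in>UNIV. l $ i) = 1"
    and l_comb: "(\<Sum>i\<in>UNIV. l $ i *\<^sub>R (X i - x0)) = t *\<^sub>R v"
    using bary_coords_convex_weights [OF assms(1-3)] by (simp_all add: l_def)
  have "g \<bullet> (t *\<^sub>R v) = (\<Sum>i\<in>UNIV. l $ i * (g \<bullet> (X i - x0)))"
    by (simp flip: l_comb add: inner_sum_right)
  moreover have "u x0 = (\<Sum>i\<in>UNIV. l $ i * u x0)"
    by (simp flip: sum_distrib_right add: l_sum)
  ultimately have
    "(\<Sum>i\<in>UNIV. l $ i * u (X i)) - u x0 - g \<bullet> (t *\<^sub>R v)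
      = (\<Sum>i\<in>UNIV. l $ i * (u (X i) - u x0 - g \<bullet> (X i - x0)))"
    by (simp add: right_diff_distrib sum_subtractf)
  also have "\<bar>\<dots>\<bar> \<le> (\<Sum>i\<in>UNIV. l $ i * E)"
    using l_nonneg rem by (intro order_trans [OF sum_abs] sum_mono) (auto simp: abs_mult intro: mult_left_mono)
  also have "\<dots> = E"
    by (simp flip: sum_distrib_right add: l_sum)
  finally have "\<bar>(\<Sum>i\<in>UNIV. l $ i * u (X i)) - u x0 - g \<bullet> (t *\<^sub>R v)\<bar> / t \<le> E / t"
    using \<open>t > 0\<close> by (simp add: divide_right_mono)
  moreover have "dir_scheme u x0 X t v - v \<bullet> g
      = ((\<Sum>i\<in>UNIV. l $ i * u (X i)) - u x0 - g \<bullet> (t *\<^sub>R v)) / t"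
    using \<open>t > 0\<close> by (simp add: dir_scheme_def lin_interp_def l_def inner_commute field_simps)
  ultimately show ?thesis
    using \<open>t > 0\<close> by simp
qed

section \<open>Search radii and the error constant\<close>

lemma dim_const_pos: "dim_const n > 0"
  by (simp add: dim_const_def add_pos_pos)

text \<open>For \<open>d\<theta> / 2\<close> strictly between \<open>0\<close> and \<open>pi / 2\<close> the cosecant exceeds 1. This keeps the step
  length \<open>t\<close>, by which the scheme divides, away from 0 at the scale of \<open>h\<close>.\<close>

lemma min_radius_pos:
  assumes "0 < d\<theta>" and "d\<theta> < pi" and "h > 0"
  shows "min_radius n d\<theta> h > 0"
proof -
  have "sin (d\<theta> / 2) > 0"
    using assms by (intro sin_gt_zero) auto
  moreover have "sin (d\<theta> / 2) < sin (pi / 2)"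
    using assms by (intro sin_monotone_2pi) auto
  ultimately have "1 / sin (d\<theta> / 2) > 1"
    by (simp add: field_simps)
  then show ?thesis
    using assms dim_const_pos by (simp add: min_radius_def)
qed

lemma dir_scheme_admissible_error:
  fixes u :: "real ^ 'n \<Rightarrow> real"
  assumes "0 < d\<theta>" and "d\<theta> < pi" and "h > 0" and "K \<ge> 0"
    and taylor: "\<And>x y. x \<in> S \<Longrightarrow> y \<in> S \<Longrightarrow>
      \<bar>u y - u x - grad_within S u x \<bullet> (y - x)\<bar> \<le> K * (norm (y - x))\<^sup>2"
    and "\<G> \<subseteq> S" and "x0 \<in> \<G>" and adm: "admissible \<G> d\<theta> h x0 v X t"
  shows "\<bar>dir_scheme u x0 X t v - v \<bullet> grad_within S u x0\<bar>
    \<le> K * (max_radius CARD('n) d\<theta> h)\<^sup>2 / min_radius CARD('n) d\<theta> h"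
proof -
  let ?R = "max_radius CARD('n) d\<theta> h" and ?r = "min_radius CARD('n) d\<theta> h"
  have r: "?r > 0"
    using assms by (intro min_radius_pos)
  have X: "X i \<in> \<G>" "norm (X i - x0) \<le> ?R" and t: "?r \<le> t" for i
    using adm by (auto simp: admissible_def)
  have "\<bar>u (X i) - u x0 - grad_within S u x0 \<bullet> (X i - x0)\<bar> \<le> K * ?R\<^sup>2" for i
  proof -
    have "\<bar>u (X i) - u x0 - grad_within S u x0 \<bullet> (X i - x0)\<bar> \<le> K * (norm (X i - x0))\<^sup>2"
      using X assms by (intro taylor) auto
    also have "\<dots> \<le> K * ?R\<^sup>2"
      using X \<open>K \<ge> 0\<close> by (intro mult_left_mono power_mono) auto
    finally show ?thesis .
  qed
  then have "\<bar>dir_scheme u x0 X t v - v \<bullet> grad_within S u x0\<bar> \<le> K * ?R\<^sup>2 / t"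
    using adm r t by (intro dir_scheme_error) (auto simp: admissible_def)
  also have "\<dots> \<le> K * ?R\<^sup>2 / ?r"
    using r t \<open>K \<ge> 0\<close> by (intro divide_left_mono) auto
  finally show ?thesis .
qed

text \<open>Both radii are homogeneous of degree 1 in \<open>h\<close>, so the quotient that bounds the error is
  linear in \<open>h\<close>.\<close>

lemma radii_quotient_linear:
  assumes "h > 0"
  shows "(max_radius n d\<theta> h)\<^sup>2 / min_radius n d\<theta> h
    = (max_radius n d\<theta> 1)\<^sup>2 / min_radius n d\<theta> 1 * h"
proof -
  have "max_radius n d\<theta> h = h * max_radius n d\<theta> 1" "min_radius n d\<theta> h = h * min_radius n d\<theta> 1"
    by (simp_all add: max_radius_def min_radius_def)
  then show ?thesis
    using assms by (simp add: power2_eq_square)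
qed

theorem lemma5:
  fixes \<Omega> :: "(real ^ 'n) set" and u :: "real ^ 'n \<Rightarrow> real" and d\<theta> :: real
  assumes "CARD('n) = 2 \<or> CARD('n) = 3"
    and "open \<Omega>" and "convex \<Omega>" and "bounded \<Omega>" and "\<Omega> \<noteq> {}" and "lipschitz_boundary \<Omega>"
    and "smooth_bounded_on (closure \<Omega>) u"
    and "0 < d\<theta>" and "d\<theta> < pi"
  shows "\<exists>C. \<forall>\<^sub>F h in at_right 0. \<forall>\<G> x0 w.
           finite \<G> \<longrightarrow> \<G> \<subseteq> closure \<Omega> \<longrightarrow> spatial_resolution \<Omega> \<G> = h \<longrightarrow> x0 \<in> \<G> \<longrightarrow> norm w = 1 \<longrightarrow>
             (\<forall>Xp tp. admissible \<G> d\<theta> h x0 w Xp tp \<longrightarrow>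
                \<bar>dir_scheme u x0 Xp tp w - w \<bullet> grad_within (closure \<Omega>) u x0\<bar> \<le> C * h) \<and>
             (\<forall>Xm tm. admissible \<G> d\<theta> h x0 (- w) Xm tm \<longrightarrow>
                \<bar>dir_scheme u x0 Xm tm (- w) - (- w) \<bullet> grad_within (closure \<Omega>) u x0\<bar> \<le> C * h)"
proof -
  have "convex (closure \<Omega>)"
    using assms(3) by (rule convex_closure)
  then obtain K where K: "K \<ge> 0" "\<And>x y. x \<in> closure \<Omega> \<Longrightarrow> y \<in> closure \<Omega> \<Longrightarrow>
      \<bar>u y - u x - grad_within (closure \<Omega>) u x \<bullet> (y - x)\<bar> \<le> K * (norm (y - x))\<^sup>2"
    using assms(7) by (rule smooth_bounded_on_taylor_remainder) blast
  define C where "C = K * ((max_radius CARD('n) d\<theta> 1)\<^sup>2 / min_radius CARD('n) d\<theta> 1)"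
  have error: "\<bar>dir_scheme u x0 X t v - v \<bullet> grad_within (closure \<Omega>) u x0\<bar> \<le> C * h"
    if "h > 0" "\<G> \<subseteq> closure \<Omega>" "x0 \<in> \<G>" "admissible \<G> d\<theta> h x0 v X t" for h \<G> x0 v X t
    using dir_scheme_admissible_error [OF assms(8,9) that(1) K that(2-4)]
    by (simp add: C_def radii_quotient_linear [OF that(1)] mult.assoc flip: times_divide_eq_right)
  show ?thesis
    by (intro exI [of _ C] eventually_mono [OF eventually_at_right_less [of 0]])
      (use error in blast)
qed

end
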